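(* Fix a truth-value structure $\mathbf{B}$ (three-valued or two-valued). Let $\Gamma$ be a context, $T_1,T_2$ tables, $\sigma_1,\sigma_2,\tau,\tau'$ schemas with $|\tau'|=|\sigma_1|+|\sigma_2|$, and let $S,S'$ be evaluations such that $$[\![\Gamma\vdash \mathtt{SELECT}~\ast~\mathtt{FROM}~T_1{:}\sigma_1,T_2{:}\sigma_2~\mathtt{WHERE}~\mathtt{TRUE} : \tau]\!]^{\mathbf{B}}\Downarrow S,$$ $$[\![\Gamma\vdash \mathtt{SELECT}~(1.\sigma_1,0.\sigma_2){:}\tau'~\mathtt{FROM}~T_2{:}\sigma_2,T_1{:}\sigma_1~\mathtt{WHERE}~\mathtt{TRUE} : \tau']\!]^{\mathbf{B}}\Downarrow S'.$$ Then for every environment $\eta$ for $\Gamma$, $S\,\eta$ and $S'\,\eta$ are (heterogeneously) equal, i.e. they are the same multiset of tuples (their arities $|\tau|$ and $|\tau'|$ coincide).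
   Context: Here, for an index $n$ and schema $\sigma=x_1,\dots,x_k$, $n.\sigma$ denotes the term list $n.x_1,\dots,n.x_k$; $(1.\sigma_1,0.\sigma_2){:}\tau'$ is the select list pairing the terms $1.\sigma_1,0.\sigma_2$ in order with the names of $\tau'$ in order. The semantics is as follows. Values are constants or NULL. A schema is a finite list of names; a context is a finite list of schemas. Tables are $\mathit{table}~x$ (a stored table of a database, which assigns to some names $x$ a schema $D(x)$ and a finite multiset $D_{rel}(x)$ of $|D(x)|$-tuples) or $\mathit{query}~Q$. Relations are finite multisets of tuples, with $\times$ (product, multiplicities multiply, tuples concatenate), $\sigma_p$ (filter), $\sum_{v\leftarrow r} f(v)$ (comprehension: $\#(\cdot,w)=\sum_{v:f(v)=w}\#(r,v)$), $\|\cdot\|$ (deduplication). An environment for $\Gamma=\sigma_1,\dots,\sigma_k$ is a list of value lists of lengths $|\sigma_i|$; $[\Gamma'\mapsto v]$ splits a tuple $v$ into an environment for $\Gamma'$, and $\mathbin{++}$ concatenates environments. Term semantics: $n.x$ in context $\Gamma$ evaluates (only if $x$ occurs exactly once in $\Gamma(n)$) to the entry of the $n$-th list of the environment at the position of $x$ in $\Gamma(n)$; constants/NULL evaluate to themselves. Tables: $\mathit{table}~x$ evaluates to $D_{rel}(x)$ with schema $D(x)$; $\mathit{query}~Q$ to the evaluation of $Q$. A FROM list $T_1{:}\rho_1,\dots,T_l{:}\rho_l$ in $\Gamma$ evaluates, when each $T_i$ evaluates with a schema of length $|\rho_i|$, to the context $\Gamma'=\rho_1,\dots,\rho_l$ and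 $\eta\mapsto$ the product of the $T_i$'s evaluations (the singleton of the empty tuple for $l=0$). A query $\mathtt{SELECT}~[\mathtt{DISTINCT}]~\vec{t{:}x}~\mathtt{FROM}~\vec{T{:}\rho}~\mathtt{WHERE}~c$ in $\Gamma$ has schema $\vec x$ and evaluates (when the FROM list evaluates to $\Gamma',S_F$ and $c$, $\vec t$ evaluate to $S_c,S_t$ in context $\Gamma',\Gamma$) to $\eta\mapsto\sum_{v\leftarrow\sigma_p(S_F\eta)} S_t([\Gamma'\mapsto v]\mathbin{++}\eta)$, with $p(v)$ true iff $S_c([\Gamma'\mapsto v]\mathbin{++}\eta)$ is the truth value btrue, deduplicated under DISTINCT; thus the first FROM table has de Bruijn index $0$. $\mathtt{SELECT}~\ast$ is the same with $\vec t$ the list of all terms $(i{-}1).x$, $x\in\rho_i$ in order, and schema the concatenation of $\Gamma'$. The condition $\mathtt{TRUE}$ evaluates to btrue. $\mathbf{B}$ is either Kleene three-valued logic or Boolean logic. *)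

theory Defs
  imports "HOL-Library.Multiset"
begin

datatype tv = btrue | bfalse | bmaybe

text \<open>
  Both logics live on one type. The two-valued logic uses only \<open>btrue\<close> and \<open>bfalse\<close>, on
  which the Kleene connectives are the Boolean ones; the logics differ in the outcome of an
  atomic comparison that involves NULL.
\<close>

datatype logic = Kleene | Boolean

fun null_comparison :: "logic \<Rightarrow> tv" where
  "null_comparison Kleene = bmaybe"
| "null_comparison Boolean = bfalse"

definition of_bool_tv :: "bool \<Rightarrow> tv" where
  "of_bool_tv b = (if b then btrue else bfalse)"

fun bneg :: "tv \<Rightarrow> tv" where
  "bneg btrue = bfalse"
| "bneg bfalse = btrue"
| "bneg bmaybe = bmaybe"

definition band :: "tv \<Rightarrow> tv \<Rightarrow> tv" where
  "band a b = (if a = bfalse \<or> b = bfalse then bfalse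
               else if a = bmaybe \<or> b = bmaybe then bmaybe else btrue)"

definition bor :: "tv \<Rightarrow> tv \<Rightarrow> tv" where
  "bor a b = bneg (band (bneg a) (bneg b))"

datatype 'c val = Null | Const (the_const: 'c)

type_synonym 'n schema = "'n list"
type_synonym 'n ctx = "'n schema list"

datatype ('n, 'c) tm = TConst 'c | TNull | TVar nat 'n

text \<open>
  The first component of \<open>Select\<close> and \<open>SelectStar\<close> is the DISTINCT flag; that of \<open>QUnion\<close>,
  \<open>QIntersect\<close> and \<open>QExcept\<close> is the ALL flag. The flag of \<open>CIsNull\<close> and \<open>CIn\<close> is \<open>False\<close> for
  the NOT variant. \<open>CPred n p ts\<close> is an \<open>n\<close>-ary predicate on constants.
\<close>

datatype ('n, 'c) query =
    Select bool "(('n, 'c) tm \<times> 'n) list" "(('n, 'c) table \<times> 'n schema) list" "('n, 'c) cond"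
  | is_SelectStar: SelectStar bool "(('n, 'c) table \<times> 'n schema) list" "('n, 'c) cond"
  | QUnion bool "('n, 'c) query" "('n, 'c) query"
  | QIntersect bool "('n, 'c) query" "('n, 'c) query"
  | QExcept bool "('n, 'c) query" "('n, 'c) query"
and ('n, 'c) table =
    Table 'n
  | Query "('n, 'c) query"
and ('n, 'c) cond =
    CTrue
  | CFalse
  | CIsNull bool "('n, 'c) tm"
  | CIsTrue "('n, 'c) cond"
  | CPred nat "'c list \<Rightarrow> bool" "('n, 'c) tm list"
  | CIn bool "('n, 'c) tm list" "('n, 'c) query"
  | CExists "('n, 'c) query"
  | CAnd "('n, 'c) cond" "('n, 'c) cond"
  | COr "('n, 'c) cond" "('n, 'c) cond"
  | CNot "('n, 'c) cond"

type_synonym ('n, 'c) from_list = "(('n, 'c) table \<times> 'n schema) list"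

text \<open>The term list \<open>n.\<sigma>\<close>.\<close>

definition qualify :: "nat \<Rightarrow> 'n schema \<Rightarrow> ('n, 'c) tm list" where
  "qualify n \<sigma> = map (TVar n) \<sigma>"

definition star_terms :: "'n ctx \<Rightarrow> ('n, 'c) tm list" where
  "star_terms \<Gamma> = concat (map (\<lambda>i. qualify i (\<Gamma> ! i)) [0..<length \<Gamma>])"

type_synonym 'c tuple = "'c val list"
type_synonym 'c rel = "'c tuple multiset"
type_synonym 'c env = "'c val list list"

definition rel_times :: "'c rel \<Rightarrow> 'c rel \<Rightarrow> 'c rel" where
  "rel_times R R' = (\<Sum>v\<in>#R. {# v @ w. w \<in># R' #})"

definition dedup :: "'a multiset \<Rightarrow> 'a multiset" where
  "dedup R = mset_set (set_mset R)"

definition dedup_if :: "bool \<Rightarrow> 'a multiset \<Rightarrow> 'a multiset" where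
  "dedup_if b R = (if b then dedup R else R)"

record ('n, 'c) database =
  db_schema :: "'n \<Rightarrow> 'n schema option"
  db_rel :: "'n \<Rightarrow> 'c rel"

definition wf_database :: "('n, 'c) database \<Rightarrow> bool" where
  "wf_database D \<longleftrightarrow>
     (\<forall>x \<sigma>. db_schema D x = Some \<sigma> \<longrightarrow> (\<forall>v \<in># db_rel D x. length v = length \<sigma>))"

definition env_for :: "'n ctx \<Rightarrow> 'c env \<Rightarrow> bool" where
  "env_for \<Gamma> \<eta> \<longleftrightarrow> list_all2 (\<lambda>\<sigma> vs. length vs = length \<sigma>) \<Gamma> \<eta>"

text \<open>\<open>split_env \<Gamma>' v\<close> is \<open>[\<Gamma>' \<mapsto> v]\<close>.\<close>

fun split_env :: "'n ctx \<Rightarrow> 'c tuple \<Rightarrow> 'c env" where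
  "split_env [] v = []"
| "split_env (\<sigma> # \<Gamma>) v = take (length \<sigma>) v # split_env \<Gamma> (drop (length \<sigma>) v)"

definition sem_filter :: "'n ctx \<Rightarrow> ('c env \<Rightarrow> 'c rel) \<Rightarrow> ('c env \<Rightarrow> tv) \<Rightarrow> 'c env \<Rightarrow> 'c rel" where
  "sem_filter \<Gamma>' S\<^sub>F S\<^sub>c \<eta> = {# v \<in># S\<^sub>F \<eta>. S\<^sub>c (split_env \<Gamma>' v @ \<eta>) = btrue #}"

definition sem_select ::
  "bool \<Rightarrow> 'n ctx \<Rightarrow> ('c env \<Rightarrow> 'c rel) \<Rightarrow> ('c env \<Rightarrow> tv) \<Rightarrow> ('c env \<Rightarrow> 'c tuple) \<Rightarrow> 'c env \<Rightarrow> 'c rel" where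
  "sem_select b \<Gamma>' S\<^sub>F S\<^sub>c S\<^sub>t \<eta> =
     dedup_if b {# S\<^sub>t (split_env \<Gamma>' v @ \<eta>). v \<in># sem_filter \<Gamma>' S\<^sub>F S\<^sub>c \<eta> #}"

definition sem_pred :: "logic \<Rightarrow> ('c list \<Rightarrow> bool) \<Rightarrow> 'c tuple \<Rightarrow> tv" where
  "sem_pred B p vs =
     (if Null \<in> set vs then null_comparison B else of_bool_tv (p (map the_const vs)))"

definition val_eq :: "logic \<Rightarrow> 'c val \<Rightarrow> 'c val \<Rightarrow> tv" where
  "val_eq B v w = (if v = Null \<or> w = Null then null_comparison B else of_bool_tv (v = w))"

definition tuple_eq :: "logic \<Rightarrow> 'c tuple \<Rightarrow> 'c tuple \<Rightarrow> tv" where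
  "tuple_eq B vs ws = foldr band (map2 (val_eq B) vs ws) btrue"

text \<open>The disjunction of the comparisons of \<open>vs\<close> with the tuples of \<open>R\<close>.\<close>

definition sem_in :: "logic \<Rightarrow> 'c tuple \<Rightarrow> 'c rel \<Rightarrow> tv" where
  "sem_in B vs R =
     (if \<exists>ws \<in># R. tuple_eq B vs ws = btrue then btrue
      else if \<exists>ws \<in># R. tuple_eq B vs ws = bmaybe then bmaybe
      else bfalse)"

inductive eval_tm :: "'n ctx \<Rightarrow> ('n, 'c) tm \<Rightarrow> ('c env \<Rightarrow> 'c val) \<Rightarrow> bool" where
  Const: "eval_tm \<Gamma> (TConst c) (\<lambda>\<eta>. Const c)"
| Null: "eval_tm \<Gamma> TNull (\<lambda>\<eta>. Null)"
| Var: "n < length \<Gamma> \<Longrightarrow> count_list (\<Gamma> ! n) x = 1 \<Longrightarrow> i < length (\<Gamma> ! n) \<Longrightarrow> \<Gamma> ! n ! i = x \<Longrightarrow>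
    eval_tm \<Gamma> (TVar n x) (\<lambda>\<eta>. \<eta> ! n ! i)"

inductive eval_tms :: "'n ctx \<Rightarrow> ('n, 'c) tm list \<Rightarrow> ('c env \<Rightarrow> 'c tuple) \<Rightarrow> bool" where
  Nil: "eval_tms \<Gamma> [] (\<lambda>\<eta>. [])"
| Cons: "eval_tm \<Gamma> t S \<Longrightarrow> eval_tms \<Gamma> ts S' \<Longrightarrow> eval_tms \<Gamma> (t # ts) (\<lambda>\<eta>. S \<eta> # S' \<eta>)"

text \<open>
  Directly under EXISTS, \<open>SELECT *\<close> only has to produce some row: its columns are not
  evaluated, so repeated names in a FROM schema do no harm there.
\<close>

inductive
  eval_query :: "logic \<Rightarrow> ('n, 'c) database \<Rightarrow> 'n ctx \<Rightarrow> ('n, 'c) query \<Rightarrow>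
    'n schema \<Rightarrow> ('c env \<Rightarrow> 'c rel) \<Rightarrow> bool" and
  eval_table :: "logic \<Rightarrow> ('n, 'c) database \<Rightarrow> 'n ctx \<Rightarrow> ('n, 'c) table \<Rightarrow>
    'n schema \<Rightarrow> ('c env \<Rightarrow> 'c rel) \<Rightarrow> bool" and
  eval_from :: "logic \<Rightarrow> ('n, 'c) database \<Rightarrow> 'n ctx \<Rightarrow> ('n, 'c) from_list \<Rightarrow>
    'n ctx \<Rightarrow> ('c env \<Rightarrow> 'c rel) \<Rightarrow> bool" and
  eval_cond :: "logic \<Rightarrow> ('n, 'c) database \<Rightarrow> 'n ctx \<Rightarrow> ('n, 'c) cond \<Rightarrow>
    ('c env \<Rightarrow> tv) \<Rightarrow> bool" and
  eval_exists :: "logic \<Rightarrow> ('n, 'c) database \<Rightarrow> 'n ctx \<Rightarrow> ('n, 'c) query \<Rightarrow>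
    ('c env \<Rightarrow> bool) \<Rightarrow> bool"
  for B :: logic and D :: "('n, 'c) database" where
  Select:
    "eval_from B D \<Gamma> G \<Gamma>' S\<^sub>F \<Longrightarrow>
     eval_cond B D (\<Gamma>' @ \<Gamma>) c S\<^sub>c \<Longrightarrow>
     eval_tms (\<Gamma>' @ \<Gamma>) (map fst txs) S\<^sub>t \<Longrightarrow>
     eval_query B D \<Gamma> (Select b txs G c) (map snd txs) (sem_select b \<Gamma>' S\<^sub>F S\<^sub>c S\<^sub>t)"
| SelectStar:
    "eval_from B D \<Gamma> G \<Gamma>' S\<^sub>F \<Longrightarrow>
     eval_cond B D (\<Gamma>' @ \<Gamma>) c S\<^sub>c \<Longrightarrow>
     eval_tms (\<Gamma>' @ \<Gamma>) (star_terms \<Gamma>') S\<^sub>t \<Longrightarrow>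
     eval_query B D \<Gamma> (SelectStar b G c) (concat \<Gamma>') (sem_select b \<Gamma>' S\<^sub>F S\<^sub>c S\<^sub>t)"
| QUnion:
    "eval_query B D \<Gamma> Q \<tau> S \<Longrightarrow> eval_query B D \<Gamma> Q' \<tau> S' \<Longrightarrow>
     eval_query B D \<Gamma> (QUnion all Q Q') \<tau> (\<lambda>\<eta>. dedup_if (\<not> all) (S \<eta> + S' \<eta>))"
| QIntersect:
    "eval_query B D \<Gamma> Q \<tau> S \<Longrightarrow> eval_query B D \<Gamma> Q' \<tau> S' \<Longrightarrow>
     eval_query B D \<Gamma> (QIntersect all Q Q') \<tau> (\<lambda>\<eta>. dedup_if (\<not> all) (S \<eta> \<inter># S' \<eta>))"
| QExcept:
    "eval_query B D \<Gamma> Q \<tau> S \<Longrightarrow> eval_query B D \<Gamma> Q' \<tau> S' \<Longrightarrow>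
     eval_query B D \<Gamma> (QExcept all Q Q') \<tau> (\<lambda>\<eta>. dedup_if (\<not> all) (S \<eta>) - S' \<eta>)"
| Table:
    "db_schema D x = Some \<sigma> \<Longrightarrow> eval_table B D \<Gamma> (Table x) \<sigma> (\<lambda>\<eta>. db_rel D x)"
| Query:
    "eval_query B D \<Gamma> Q \<tau> S \<Longrightarrow> eval_table B D \<Gamma> (Query Q) \<tau> S"
| From_Nil:
    "eval_from B D \<Gamma> [] [] (\<lambda>\<eta>. {# [] #})"
| From_Cons:
    "eval_table B D \<Gamma> T \<sigma> S \<Longrightarrow> length \<sigma> = length \<rho> \<Longrightarrow> eval_from B D \<Gamma> G \<Gamma>' S' \<Longrightarrow>
     eval_from B D \<Gamma> ((T, \<rho>) # G) (\<rho> # \<Gamma>') (\<lambda>\<eta>. rel_times (S \<eta>) (S' \<eta>))"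
| CTrue:
    "eval_cond B D \<Gamma> CTrue (\<lambda>\<eta>. btrue)"
| CFalse:
    "eval_cond B D \<Gamma> CFalse (\<lambda>\<eta>. bfalse)"
| CIsNull:
    "eval_tm \<Gamma> t S \<Longrightarrow>
     eval_cond B D \<Gamma> (CIsNull b t) (\<lambda>\<eta>. of_bool_tv ((S \<eta> = Null) = b))"
| CIsTrue:
    "eval_cond B D \<Gamma> c S \<Longrightarrow> eval_cond B D \<Gamma> (CIsTrue c) (\<lambda>\<eta>. of_bool_tv (S \<eta> = btrue))"
| CPred:
    "eval_tms \<Gamma> ts S \<Longrightarrow> length ts = n \<Longrightarrow>
     eval_cond B D \<Gamma> (CPred n p ts) (\<lambda>\<eta>. sem_pred B p (S \<eta>))"
| CIn:
    "eval_tms \<Gamma> ts S \<Longrightarrow> eval_query B D \<Gamma> Q \<tau> S' \<Longrightarrow> length ts = length \<tau> \<Longrightarrow>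
     eval_cond B D \<Gamma> (CIn b ts Q)
       (\<lambda>\<eta>. if b then sem_in B (S \<eta>) (S' \<eta>) else bneg (sem_in B (S \<eta>) (S' \<eta>)))"
| CExists:
    "eval_exists B D \<Gamma> Q S \<Longrightarrow> eval_cond B D \<Gamma> (CExists Q) (\<lambda>\<eta>. of_bool_tv (S \<eta>))"
| CAnd:
    "eval_cond B D \<Gamma> c S \<Longrightarrow> eval_cond B D \<Gamma> c' S' \<Longrightarrow>
     eval_cond B D \<Gamma> (CAnd c c') (\<lambda>\<eta>. band (S \<eta>) (S' \<eta>))"
| COr:
    "eval_cond B D \<Gamma> c S \<Longrightarrow> eval_cond B D \<Gamma> c' S' \<Longrightarrow>
     eval_cond B D \<Gamma> (COr c c') (\<lambda>\<eta>. bor (S \<eta>) (S' \<eta>))"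
| CNot:
    "eval_cond B D \<Gamma> c S \<Longrightarrow> eval_cond B D \<Gamma> (CNot c) (\<lambda>\<eta>. bneg (S \<eta>))"
| Exists_Star:
    "eval_from B D \<Gamma> G \<Gamma>' S\<^sub>F \<Longrightarrow>
     eval_cond B D (\<Gamma>' @ \<Gamma>) c S\<^sub>c \<Longrightarrow>
     eval_exists B D \<Gamma> (SelectStar b G c) (\<lambda>\<eta>. sem_filter \<Gamma>' S\<^sub>F S\<^sub>c \<eta> \<noteq> {#})"
| Exists_Other:
    "\<not> is_SelectStar Q \<Longrightarrow> eval_query B D \<Gamma> Q \<tau> S \<Longrightarrow>
     eval_exists B D \<Gamma> Q (\<lambda>\<eta>. S \<eta> \<noteq> {#})"

end

theory Submission
  imports Defs
begin

text \<open>
  Evaluation is functional, so both queries see the same semantics \<open>R\<^sub>1\<close>, \<open>R\<^sub>2\<close> of the two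
  tables. All tuples of \<open>R\<^sub>i \<eta>\<close> have length \<open>|\<sigma>\<^sub>i|\<close>, and a list \<open>n.\<sigma>\<close> that evaluates has no
  repeated names and returns the whole \<open>n\<close>-th list of the environment. Hence the select lists map
  \<open>v @ w\<close> and \<open>w @ v\<close>, for \<open>v \<in> R\<^sub>1 \<eta>\<close> and \<open>w \<in> R\<^sub>2 \<eta>\<close>, to the same tuple \<open>v @ w\<close>, and the
  claim is the commutation of two finite sums.
\<close>

section \<open>Determinism of evaluation\<close>

text \<open>The count is the cardinality of the set of positions holding \<open>x\<close>, so that
  set is a singleton. The rule \<open>Var\<close> allows any such position \<open>i\<close>; this
  makes its choice unique.\<close>

lemma count_list_one_nth_inj:
  assumes "count_list xs x = 1" "i < length xs" "j < length xs" "xs ! i = x" "xs ! j = x"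
  shows "i = j"
proof -
  have "card {k. k < length xs \<and> x = xs ! k} = 1"
    using assms(1) by (simp add: count_list_eq_length_filter length_filter_conv_card)
  then obtain k where k: "{k. k < length xs \<and> x = xs ! k} = {k}"
    by (rule card_1_singletonE)
  have "i \<in> {k}" "j \<in> {k}"
    unfolding k[symmetric] using assms by auto
  then show ?thesis
    by simp
qed

inductive_cases eval_tm_ConstE: "eval_tm \<Gamma> (TConst c) S"
inductive_cases eval_tm_NullE: "eval_tm \<Gamma> TNull S"
inductive_cases eval_tm_VarE: "eval_tm \<Gamma> (TVar n x) S"
inductive_cases eval_tms_NilE: "eval_tms \<Gamma> [] S"
inductive_cases eval_tms_ConsE: "eval_tms \<Gamma> (t # ts) S"

lemma eval_tm_det: "eval_tm \<Gamma> t S \<Longrightarrow> eval_tm \<Gamma> t S' \<Longrightarrow> S' = S"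
proof (induction rule: eval_tm.induct)
  case (Var n \<Gamma> x i)
  from Var.prems obtain j where "j < length (\<Gamma> ! n)" "\<Gamma> ! n ! j = x" "S' = (\<lambda>\<eta>. \<eta> ! n ! j)"
    by (rule eval_tm_VarE)
  then show ?case
    using Var.hyps count_list_one_nth_inj[of "\<Gamma> ! n" x i j] by simp
qed (auto elim: eval_tm_ConstE eval_tm_NullE)

lemma eval_tms_det: "eval_tms \<Gamma> ts S \<Longrightarrow> eval_tms \<Gamma> ts S' \<Longrightarrow> S' = S"
proof (induction arbitrary: S' rule: eval_tms.induct)
  case (Cons \<Gamma> t S ts S'')
  from Cons.prems obtain U U' where "eval_tm \<Gamma> t U" "eval_tms \<Gamma> ts U'" "S' = (\<lambda>\<eta>. U \<eta> # U' \<eta>)"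
    by (rule eval_tms_ConsE)
  then show ?case
    using Cons.IH eval_tm_det[OF Cons.hyps(1)] by blast
qed (auto elim: eval_tms_NilE)

inductive_cases eval_query_SelectE: "eval_query B D \<Gamma> (Select b txs G c) \<tau> S"
inductive_cases eval_query_SelectStarE: "eval_query B D \<Gamma> (SelectStar b G c) \<tau> S"
inductive_cases eval_query_UnionE: "eval_query B D \<Gamma> (QUnion a Q Q') \<tau> S"
inductive_cases eval_query_IntersectE: "eval_query B D \<Gamma> (QIntersect a Q Q') \<tau> S"
inductive_cases eval_query_ExceptE: "eval_query B D \<Gamma> (QExcept a Q Q') \<tau> S"
inductive_cases eval_table_TableE: "eval_table B D \<Gamma> (Table x) \<tau> S"
inductive_cases eval_table_QueryE: "eval_table B D \<Gamma> (Query Q) \<tau> S"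
inductive_cases eval_from_NilE: "eval_from B D \<Gamma> [] \<Gamma>' S"
inductive_cases eval_from_ConsE: "eval_from B D \<Gamma> ((T, \<rho>) # G) \<Gamma>' S"
inductive_cases eval_cond_TrueE: "eval_cond B D \<Gamma> CTrue S"
inductive_cases eval_cond_FalseE: "eval_cond B D \<Gamma> CFalse S"
inductive_cases eval_cond_IsNullE: "eval_cond B D \<Gamma> (CIsNull b t) S"
inductive_cases eval_cond_IsTrueE: "eval_cond B D \<Gamma> (CIsTrue c) S"
inductive_cases eval_cond_PredE: "eval_cond B D \<Gamma> (CPred n p ts) S"
inductive_cases eval_cond_InE: "eval_cond B D \<Gamma> (CIn b ts Q) S"
inductive_cases eval_cond_ExistsE: "eval_cond B D \<Gamma> (CExists Q) S"
inductive_cases eval_cond_AndE: "eval_cond B D \<Gamma> (CAnd c c') S"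
inductive_cases eval_cond_OrE: "eval_cond B D \<Gamma> (COr c c') S"
inductive_cases eval_cond_NotE: "eval_cond B D \<Gamma> (CNot c) S"
inductive_cases eval_existsE: "eval_exists B D \<Gamma> Q S"

text \<open>The five judgements are mutually recursive, so determinism is proved for all at once.
  Each case inverts the second derivation. \<open>IH\<close> alternates a premise with the induction
  hypothesis for it, hence the even indices.\<close>

lemma eval_det:
  shows eval_query_det:
      "eval_query B D \<Gamma> Q \<tau> S \<Longrightarrow> eval_query B D \<Gamma> Q \<tau>' S' \<Longrightarrow> \<tau>' = \<tau> \<and> S' = S"
    and eval_table_det:
      "eval_table B D \<Gamma> T \<tau> S \<Longrightarrow> eval_table B D \<Gamma> T \<tau>' S' \<Longrightarrow> \<tau>' = \<tau> \<and> S' = S"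
    and eval_from_det:
      "eval_from B D \<Gamma> G \<Gamma>' S \<Longrightarrow> eval_from B D \<Gamma> G \<Gamma>'' S' \<Longrightarrow> \<Gamma>'' = \<Gamma>' \<and> S' = S"
    and eval_cond_det:
      "eval_cond B D \<Gamma> c K \<Longrightarrow> eval_cond B D \<Gamma> c K' \<Longrightarrow> K' = K"
    and eval_exists_det:
      "eval_exists B D \<Gamma> Q E \<Longrightarrow> eval_exists B D \<Gamma> Q E' \<Longrightarrow> E' = E"
proof (induction arbitrary: \<tau>' S' and \<tau>' S' and \<Gamma>'' S' and K' and E'
    rule: eval_query_eval_table_eval_from_eval_cond_eval_exists.inducts)
  case Select
  \<comment> \<open>The FROM list has to come first: only after the two contexts \<Gamma>' are
    identified do the condition and the terms of both derivations live in the same context.\<close>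
  from Select.prems show ?case
    by (auto elim!: eval_query_SelectE
        dest!: Select.IH(2,4) eval_tms_det[OF Select.hyps])
next
  case SelectStar
  from SelectStar.prems show ?case
    by (auto elim!: eval_query_SelectStarE
        dest!: SelectStar.IH(2,4) eval_tms_det[OF SelectStar.hyps])
next
  case QUnion
  from QUnion.prems show ?case
    by (auto elim!: eval_query_UnionE
        dest!: QUnion.IH(2,4))
next
  case QIntersect
  from QIntersect.prems show ?case
    by (auto elim!: eval_query_IntersectE
        dest!: QIntersect.IH(2,4))
next
  case QExcept
  from QExcept.prems show ?case
    by (auto elim!: eval_query_ExceptE
        dest!: QExcept.IH(2,4))
next
  case Table
  then show ?case
    by (auto elim: eval_table_TableE)
next
  case Query
  from Query.prems show ?case
    by (auto elim!: eval_table_QueryE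
        dest!: Query.IH(2))
next
  case From_Nil
  then show ?case
    by (auto elim: eval_from_NilE)
next
  case From_Cons
  from From_Cons.prems show ?case
    by (auto elim!: eval_from_ConsE
        dest!: From_Cons.IH(2,4))
next
  case CTrue
  then show ?case
    by (auto elim: eval_cond_TrueE)
next
  case CFalse
  then show ?case
    by (auto elim: eval_cond_FalseE)
next
  case CIsNull
  from CIsNull.prems show ?case
    by (auto elim!: eval_cond_IsNullE
        dest!: eval_tm_det[OF CIsNull.hyps])
next
  case CIsTrue
  from CIsTrue.prems show ?case
    by (auto elim!: eval_cond_IsTrueE
        dest!: CIsTrue.IH(2))
next
  case CPred
  from CPred.prems show ?case
    by (auto elim!: eval_cond_PredE
        dest!: eval_tms_det[OF CPred.hyps(1)])
next
  case CIn
  from CIn.prems show ?case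
    by (auto elim!: eval_cond_InE
        dest!: CIn.IH(2) eval_tms_det[OF CIn.hyps(1)])
next
  case CExists
  from CExists.prems show ?case
    by (auto elim!: eval_cond_ExistsE
        dest!: CExists.IH(2))
next
  case CAnd
  from CAnd.prems show ?case
    by (auto elim!: eval_cond_AndE
        dest!: CAnd.IH(2,4))
next
  case COr
  from COr.prems show ?case
    by (auto elim!: eval_cond_OrE
        dest!: COr.IH(2,4))
next
  case CNot
  from CNot.prems show ?case
    by (auto elim!: eval_cond_NotE
        dest!: CNot.IH(2))
next
  case Exists_Star
  from Exists_Star.prems show ?case
    by (auto elim!: eval_existsE
        dest!: Exists_Star.IH(2,4))
next
  case Exists_Other
  \<comment> \<open>Two rules can derive \<open>eval_exists\<close>; \<open>is_SelectStar\<close>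
    keeps them disjoint, so the inverted derivation ends in the same rule.\<close>
  from Exists_Other.prems Exists_Other.hyps show ?case
    by (auto elim!: eval_existsE
        dest!: Exists_Other.IH(2))
qed

section \<open>Arities\<close>

lemma eval_tms_length: "eval_tms \<Gamma> ts S \<Longrightarrow> length (S \<eta>) = length ts"
  by (induction rule: eval_tms.induct) auto

lemma length_star_terms: "length (star_terms \<Gamma>) = length (concat \<Gamma>)"
proof -
  have "map (\<lambda>i. length (\<Gamma> ! i)) [0..<length \<Gamma>] = map length \<Gamma>"
    by (rule nth_equalityI) simp_all
  then show ?thesis
    by (simp add: star_terms_def qualify_def length_concat comp_def)
qed

lemma in_dedup_if [simp]: "v \<in># dedup_if b R \<longleftrightarrow> v \<in># R"
  by (simp add: dedup_if_def dedup_def)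

lemma in_sem_select_length:
  assumes "eval_tms \<Gamma> ts S\<^sub>t" "v \<in># sem_select b \<Gamma>' S\<^sub>F S\<^sub>c S\<^sub>t \<eta>"
  shows "length v = length ts"
  using assms(2) eval_tms_length[OF assms(1)] by (auto simp: sem_select_def)

text \<open>In a SELECT the tuple length is that of the term list, whatever the FROM list yields. So
  only queries and tables need a claim, and \<open>wf_database\<close> settles stored
  tables.\<close>

lemma eval_arity:
  assumes "wf_database D"
  shows eval_query_arity:
      "eval_query B D \<Gamma> Q \<tau> S \<Longrightarrow> v \<in># S \<eta> \<Longrightarrow> length v = length \<tau>"
    and eval_table_arity:
      "eval_table B D \<Gamma> T \<tau> S \<Longrightarrow> v \<in># S \<eta> \<Longrightarrow> length v = length \<tau>"
    and "eval_from B D \<Gamma> G \<Gamma>' S \<Longrightarrow> True"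
    and "eval_cond B D \<Gamma> c K \<Longrightarrow> True"
    and "eval_exists B D \<Gamma> Q E \<Longrightarrow> True"
proof (induction rule: eval_query_eval_table_eval_from_eval_cond_eval_exists.inducts)
  case Select
  from in_sem_select_length[OF Select.hyps Select.prems] show ?case
    by simp
next
  case SelectStar
  from in_sem_select_length[OF SelectStar.hyps SelectStar.prems] show ?case
    by (simp only: length_star_terms)
next
  case QExcept
  \<comment> \<open>With or without deduplication, a tuple of the difference occurs in the first
    operand.\<close>
  from in_diffD[OF QExcept.prems] QExcept.IH(2) show ?case
    by simp
next
  case Table
  with assms show ?case
    by (simp add: wf_database_def)
qed auto

section \<open>Swapping the tables\<close>

lemma eval_tms_append:
  "eval_tms \<Gamma> (ts @ ts') S \<Longrightarrow>
   \<exists>U U'. eval_tms \<Gamma> ts U \<and> eval_tms \<Gamma> ts' U' \<and> S = (\<lambda>\<eta>. U \<eta> @ U' \<eta>)"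
proof (induction ts arbitrary: S)
  case Nil
  then show ?case
    using eval_tms.Nil by fastforce
next
  case (Cons t ts)
  from Cons.prems obtain V V' where V: "eval_tm \<Gamma> t V" "eval_tms \<Gamma> (ts @ ts') V'"
      "S = (\<lambda>\<eta>. V \<eta> # V' \<eta>)"
    by (auto elim: eval_tms_ConsE)
  from Cons.IH[OF V(2)] obtain U U' where "eval_tms \<Gamma> ts U" "eval_tms \<Gamma> ts' U'"
      "V' = (\<lambda>\<eta>. U \<eta> @ U' \<eta>)"
    by blast
  with V show ?case
    by (intro exI[of _ "\<lambda>\<eta>. V \<eta> # U \<eta>"] exI[of _ U']) (auto intro: eval_tms.Cons)
qed

lemma eval_tms_nth:
  "eval_tms \<Gamma> ts S \<Longrightarrow> i < length ts \<Longrightarrow> \<exists>U. eval_tm \<Gamma> (ts ! i) U \<and> (\<forall>\<eta>. S \<eta> ! i = U \<eta>)"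
  by (induction arbitrary: i rule: eval_tms.induct) (auto simp: nth_Cons split: nat.split)

text \<open>Each name has to occur exactly once in \<open>\<Gamma> ! n\<close> for its term to
  evaluate, so the terms read off the entries position by position. The length assumption ensures
  that no entry is left over.\<close>

lemma eval_tms_qualify:
  assumes S: "eval_tms \<Gamma> (qualify n (\<Gamma> ! n)) S" and len: "length (\<eta> ! n) = length (\<Gamma> ! n)"
  shows "S \<eta> = \<eta> ! n"
proof (rule nth_equalityI)
  show "length (S \<eta>) = length (\<eta> ! n)"
    using eval_tms_length[OF S] len by (simp add: qualify_def)
next
  fix i assume "i < length (S \<eta>)"
  then have i: "i < length (\<Gamma> ! n)"
    using eval_tms_length[OF S] by (simp add: qualify_def)
  obtain U where U: "eval_tm \<Gamma> (TVar n (\<Gamma> ! n ! i)) U" "S \<eta> ! i = U \<eta>"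
    using eval_tms_nth[OF S, of i] i by (auto simp: qualify_def)
  from U(1) obtain j where j: "count_list (\<Gamma> ! n) (\<Gamma> ! n ! i) = Suc 0" "j < length (\<Gamma> ! n)"
      "\<Gamma> ! n ! j = \<Gamma> ! n ! i" and U_eq: "U = (\<lambda>\<eta>. \<eta> ! n ! j)"
    by (rule eval_tm_VarE)
  \<comment> \<open>Inversion yields some position \<open>j\<close> of the \<open>i\<close>-th name;
    uniqueness of the name identifies the two.\<close>
  have "j = i"
    by (rule count_list_one_nth_inj[of "\<Gamma> ! n" "\<Gamma> ! n ! i"]) (use i j in simp_all)
  then show "S \<eta> ! i = \<eta> ! n ! i"
    using U(2) U_eq by simp
qed

lemma eval_from_two:
  assumes "eval_from B D \<Gamma> [(T, \<rho>), (T', \<rho>')] \<Gamma>' S"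
  obtains \<sigma> \<sigma>' R R' where "eval_table B D \<Gamma> T \<sigma> R" "length \<sigma> = length \<rho>"
    "eval_table B D \<Gamma> T' \<sigma>' R'" "length \<sigma>' = length \<rho>'"
    "\<Gamma>' = [\<rho>, \<rho>']" "S = (\<lambda>\<eta>. rel_times (R \<eta>) (R' \<eta>))"
proof -
  \<comment> \<open>A FROM list evaluates to nested products ending in the singleton of the empty
    tuple, which is a right unit.\<close>
  have unit: "rel_times R {# [] #} = R" for R :: "'b rel"
    by (simp add: rel_times_def)
  show thesis
    using assms that by (auto elim!: eval_from_ConsE eval_from_NilE simp: unit)
qed

lemma image_rel_times: "image_mset f (rel_times R R') = (\<Sum>v\<in>#R. {# f (v @ w). w \<in># R' #})"
  by (induction R) (simp_all add: rel_times_def image_mset.compositionality comp_def)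

lemma sum_image_mset_swap:
  "(\<Sum>v\<in>#R. {# f v w. w \<in># R' #}) = (\<Sum>w\<in>#R'. {# f v w. v \<in># R #})"
proof -
  \<comment> \<open>Written as sums of singletons, the images become a double sum whose order can be
    exchanged.\<close>
  have "(\<Sum>v\<in>#R. \<Sum>w\<in>#R'. {# f v w #}) = (\<Sum>w\<in>#R'. \<Sum>v\<in>#R. {# f v w #})"
    by (rule sum_mset.swap)
  then show ?thesis
    by simp
qed

text \<open>The products themselves may differ, since concatenation does not commute. Agreement of
  \<open>f\<close> and \<open>g\<close> is asked only on members, because it will depend on tuple
  lengths.\<close>

lemma image_rel_times_commute:
  assumes "\<And>v w. v \<in># R \<Longrightarrow> w \<in># R' \<Longrightarrow> f (v @ w) = g (w @ v)"
  shows "image_mset f (rel_times R R') = image_mset g (rel_times R' R)"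
proof -
  have "image_mset f (rel_times R R') = (\<Sum>v\<in>#R. {# g (w @ v). w \<in># R' #})"
    unfolding image_rel_times
    by (intro arg_cong[where f = sum_mset] image_mset_cong) (simp add: assms)
  also have "\<dots> = image_mset g (rel_times R' R)"
    unfolding image_rel_times by (rule sum_image_mset_swap)
  finally show ?thesis .
qed

theorem theorem1:
  fixes B :: logic and D :: "('n, 'c) database" and \<Gamma> :: "'n ctx"
    and T\<^sub>1 T\<^sub>2 :: "('n, 'c) table" and \<sigma>\<^sub>1 \<sigma>\<^sub>2 \<tau> \<tau>' :: "'n schema"
    and S S' :: "'c env \<Rightarrow> 'c rel" and \<eta> :: "'c env"
  assumes "wf_database D"
    and "length \<tau>' = length \<sigma>\<^sub>1 + length \<sigma>\<^sub>2"
    and "eval_query B D \<Gamma> (SelectStar False [(T\<^sub>1, \<sigma>\<^sub>1), (T\<^sub>2, \<sigma>\<^sub>2)] CTrue) \<tau> S"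
    and "eval_query B D \<Gamma>
           (Select False (zip (qualify 1 \<sigma>\<^sub>1 @ qualify 0 \<sigma>\<^sub>2) \<tau>') [(T\<^sub>2, \<sigma>\<^sub>2), (T\<^sub>1, \<sigma>\<^sub>1)] CTrue) \<tau>' S'"
    and "env_for \<Gamma> \<eta>"
  shows "length \<tau> = length \<tau>' \<and> S \<eta> = S' \<eta>"
proof -
  from assms(3) obtain \<Gamma>\<^sub>a F K V where a: "eval_from B D \<Gamma> [(T\<^sub>1, \<sigma>\<^sub>1), (T\<^sub>2, \<sigma>\<^sub>2)] \<Gamma>\<^sub>a F"
      "eval_cond B D (\<Gamma>\<^sub>a @ \<Gamma>) CTrue K" "eval_tms (\<Gamma>\<^sub>a @ \<Gamma>) (star_terms \<Gamma>\<^sub>a) V"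
      "\<tau> = concat \<Gamma>\<^sub>a" "S = sem_select False \<Gamma>\<^sub>a F K V"
    by (auto elim!: eval_query_SelectStarE)
  from assms(4) obtain \<Gamma>\<^sub>b F' K' V' where b: "eval_from B D \<Gamma> [(T\<^sub>2, \<sigma>\<^sub>2), (T\<^sub>1, \<sigma>\<^sub>1)] \<Gamma>\<^sub>b F'"
      "eval_cond B D (\<Gamma>\<^sub>b @ \<Gamma>) CTrue K'"
      "eval_tms (\<Gamma>\<^sub>b @ \<Gamma>) (map fst (zip (qualify 1 \<sigma>\<^sub>1 @ qualify 0 \<sigma>\<^sub>2) \<tau>')) V'"
      "S' = sem_select False \<Gamma>\<^sub>b F' K' V'"
    by (rule eval_query_SelectE)
  from a(1) obtain \<rho>\<^sub>1 \<rho>\<^sub>2 R\<^sub>1 R\<^sub>2 where R: "eval_table B D \<Gamma> T\<^sub>1 \<rho>\<^sub>1 R\<^sub>1" "length \<rho>\<^sub>1 = length \<sigma>\<^sub>1"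
      "eval_table B D \<Gamma> T\<^sub>2 \<rho>\<^sub>2 R\<^sub>2" "length \<rho>\<^sub>2 = length \<sigma>\<^sub>2"
      and \<Gamma>\<^sub>a: "\<Gamma>\<^sub>a = [\<sigma>\<^sub>1, \<sigma>\<^sub>2]" and F: "F = (\<lambda>\<eta>. rel_times (R\<^sub>1 \<eta>) (R\<^sub>2 \<eta>))"
    by (rule eval_from_two)
  \<comment> \<open>Determinism enters here: the second query evaluates the tables to the same
    \<open>R\<^sub>1\<close> and \<open>R\<^sub>2\<close>.\<close>
  from b(1) have F': "F' = (\<lambda>\<eta>. rel_times (R\<^sub>2 \<eta>) (R\<^sub>1 \<eta>))" and \<Gamma>\<^sub>b: "\<Gamma>\<^sub>b = [\<sigma>\<^sub>2, \<sigma>\<^sub>1]"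
    by (auto elim!: eval_from_two dest!: eval_table_det[OF R(1)] eval_table_det[OF R(3)])
  have K: "K = (\<lambda>\<eta>. btrue)" "K' = (\<lambda>\<eta>. btrue)"
    using a(2) b(2) by (auto elim: eval_cond_TrueE)
  have "eval_tms (\<sigma>\<^sub>1 # \<sigma>\<^sub>2 # \<Gamma>) (qualify 0 \<sigma>\<^sub>1 @ qualify 1 \<sigma>\<^sub>2) V"
    using a(3) by (simp add: \<Gamma>\<^sub>a star_terms_def)
  then obtain V\<^sub>1 V\<^sub>2 where V\<^sub>1: "eval_tms (\<sigma>\<^sub>1 # \<sigma>\<^sub>2 # \<Gamma>) (qualify 0 \<sigma>\<^sub>1) V\<^sub>1"
      and V\<^sub>2: "eval_tms (\<sigma>\<^sub>1 # \<sigma>\<^sub>2 # \<Gamma>) (qualify 1 \<sigma>\<^sub>2) V\<^sub>2" and V: "V = (\<lambda>\<eta>. V\<^sub>1 \<eta> @ V\<^sub>2 \<eta>)"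
    using eval_tms_append by blast
  \<comment> \<open>\<open>zip\<close> truncates to the shorter list; the assumed length of \<tau>'
    guarantees that no term is lost.\<close>
  have "eval_tms (\<sigma>\<^sub>2 # \<sigma>\<^sub>1 # \<Gamma>) (qualify 1 \<sigma>\<^sub>1 @ qualify 0 \<sigma>\<^sub>2) V'"
    using b(3) assms(2) by (simp add: \<Gamma>\<^sub>b qualify_def)
  then obtain W\<^sub>1 W\<^sub>2 where W\<^sub>1: "eval_tms (\<sigma>\<^sub>2 # \<sigma>\<^sub>1 # \<Gamma>) (qualify 1 \<sigma>\<^sub>1) W\<^sub>1"
      and W\<^sub>2: "eval_tms (\<sigma>\<^sub>2 # \<sigma>\<^sub>1 # \<Gamma>) (qualify 0 \<sigma>\<^sub>2) W\<^sub>2" and V': "V' = (\<lambda>\<eta>. W\<^sub>1 \<eta> @ W\<^sub>2 \<eta>)"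
    using eval_tms_append by blast
  have "V (split_env \<Gamma>\<^sub>a (v @ w) @ \<eta>) = V' (split_env \<Gamma>\<^sub>b (w @ v) @ \<eta>)"
    if "v \<in># R\<^sub>1 \<eta>" "w \<in># R\<^sub>2 \<eta>" for v w
  proof -
    \<comment> \<open>With these lengths \<open>split_env\<close> cuts both concatenations exactly
      between \<open>v\<close> and \<open>w\<close>.\<close>
    have len: "length v = length \<sigma>\<^sub>1" "length w = length \<sigma>\<^sub>2"
      using that R eval_table_arity[OF assms(1)] by metis+
    have "V (v # w # \<eta>) = v @ w"
      using eval_tms_qualify[of "\<sigma>\<^sub>1 # \<sigma>\<^sub>2 # \<Gamma>" 0 V\<^sub>1 "v # w # \<eta>"]
        eval_tms_qualify[of "\<sigma>\<^sub>1 # \<sigma>\<^sub>2 # \<Gamma>" 1 V\<^sub>2 "v # w # \<eta>"] V\<^sub>1 V\<^sub>2 len by (simp add: V)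
    moreover have "V' (w # v # \<eta>) = v @ w"
      using eval_tms_qualify[of "\<sigma>\<^sub>2 # \<sigma>\<^sub>1 # \<Gamma>" 1 W\<^sub>1 "w # v # \<eta>"]
        eval_tms_qualify[of "\<sigma>\<^sub>2 # \<sigma>\<^sub>1 # \<Gamma>" 0 W\<^sub>2 "w # v # \<eta>"] W\<^sub>1 W\<^sub>2 len by (simp add: V')
    ultimately show ?thesis
      using len by (simp add: \<Gamma>\<^sub>a \<Gamma>\<^sub>b)
  qed
  then have "S \<eta> = S' \<eta>"
    by (simp add: a(5) b(4) K F F' sem_select_def sem_filter_def dedup_if_def
        image_rel_times_commute)
  moreover have "length \<tau> = length \<tau>'"
    using a(4) assms(2) by (simp add: \<Gamma>\<^sub>a)
  ultimately show ?thesis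
    by simp
qed

end
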